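(* Let $X\subset\mathbb{C}$ be a good (perfect) compact set, let $\phi:X\to X$ and let $\phi\in D^\infty(X)$. Suppose that there is a point $b\in X$ such that $|\phi'(b)|>1$ and $\phi(b)$ has an external circular tangent. Then there is a nonanalytic weight sequence $(M_n)_{n\ge0}$ with $\phi\in D(X,M)$ such that $\phi$ does not induce an endomorphism of $D(X,M)$.
   Context: For a perfect compact set $X\subset\mathbb{C}$, a function $f:X\to\mathbb{C}$ is complex-differentiable at $a\in X$ if $f'(a)=\lim_{z\to a,\ z\in X}\frac{f(z)-f(a)}{z-a}$ exists; higher derivatives $f^{(n)}$ are defined by iteration, and $D^\infty(X)$ is the set of infinitely complex-differentiable functions on $X$. $\|\cdot\|_\infty$ is the sup norm over $X$. A weight sequence (algebra sequence) is a sequence $(M_n)_{n\ge0}$ of positive numbers with $M_0=1$ and $\binom{m+n}{n}\le\frac{M_{m+n}}{M_mM_n}$ for all $m,n\ge0$. It is nonanalytic if $\lim_{n\to\infty}(n!/M_n)^{1/n}=0$. Define $D(X,M)=\{f\in D^\infty(X):\|f\|_{D(X,M)}=\sum_{n=0}^\infty\frac{\|f^{(n)}\|_\infty}{M_n}<\infty\}$, a commutative normed algebra under pointwise operations. $X$ is called good if $D(X,M)$ is complete for all nonanalytic algebra sequences $M$. A map $\phi:X\to X$ induces an endomorphism of $D(X,M)$ if $f\circ\phi\in D(X,M)$ for all $f\in D(X,M)$. A point $c\in X$ has an external circular tangent if there is an open disc $\Delta_1$ contained in the complement of $X$ with $\overline{\Delta_1}\cap X=\{c\}$. *)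

theory Defs
  imports "HOL-Analysis.Analysis"
begin

text \<open>
  Functions on \<open>X\<close> are represented by total functions on the complex numbers of which only the
  values on \<open>X\<close> are relevant: every notion below depends on \<open>f\<close> only through its restriction
  to \<open>X\<close>.
\<close>

definition perfect_compact :: "complex set \<Rightarrow> bool" where
  "perfect_compact X \<longleftrightarrow> compact X \<and> X \<noteq> {} \<and> (\<forall>x\<in>X. x islimpt X)"

text \<open>
  The derivative is taken along \<open>X\<close>. It is unique at the points of a perfect set, and it is a
  junk value where the limit does not exist.
\<close>

definition deriv_on :: "complex set \<Rightarrow> (complex \<Rightarrow> complex) \<Rightarrow> complex \<Rightarrow> complex" where
  "deriv_on X f a = (THE d. (f has_field_derivative d) (at a within X))"

lemma deriv_on_eqI:
  assumes "(f has_field_derivative d) (at a within X)" "a islimpt X"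
  shows "deriv_on X f a = d"
  unfolding deriv_on_def
proof (rule the_equality)
  fix d' assume "(f has_field_derivative d') (at a within X)"
  moreover have "at a within X \<noteq> bot"
    using assms(2) by (simp add: trivial_limit_within)
  ultimately show "d' = d"
    using assms(1) unfolding has_field_derivative_iff by (metis tendsto_unique)
qed (fact assms(1))

primrec higher_deriv_on ::
    "complex set \<Rightarrow> nat \<Rightarrow> (complex \<Rightarrow> complex) \<Rightarrow> complex \<Rightarrow> complex" where
  "higher_deriv_on X 0 f = f"
| "higher_deriv_on X (Suc n) f = deriv_on X (higher_deriv_on X n f)"

definition D_infinity :: "complex set \<Rightarrow> (complex \<Rightarrow> complex) set" where
  "D_infinity X =
     {f. \<forall>n. \<forall>a\<in>X. higher_deriv_on X n f field_differentiable (at a within X)}"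

text \<open>
  The supremum is only used for functions that are continuous on a nonempty compact \<open>X\<close>.
\<close>

definition sup_norm_on :: "complex set \<Rightarrow> (complex \<Rightarrow> complex) \<Rightarrow> real" where
  "sup_norm_on X f = (SUP z\<in>X. cmod (f z))"

definition weight_sequence :: "(nat \<Rightarrow> real) \<Rightarrow> bool" where
  "weight_sequence M \<longleftrightarrow>
     (\<forall>n. M n > 0) \<and> M 0 = 1 \<and>
     (\<forall>m n. real ((m + n) choose n) \<le> M (m + n) / (M m * M n))"

definition nonanalytic :: "(nat \<Rightarrow> real) \<Rightarrow> bool" where
  "nonanalytic M \<longleftrightarrow> (\<lambda>n. root n (fact n / M n)) \<longlonglongrightarrow> 0"

definition D_alg :: "complex set \<Rightarrow> (nat \<Rightarrow> real) \<Rightarrow> (complex \<Rightarrow> complex) set" where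
  "D_alg X M =
     {f \<in> D_infinity X. summable (\<lambda>n. sup_norm_on X (higher_deriv_on X n f) / M n)}"

definition D_norm :: "complex set \<Rightarrow> (nat \<Rightarrow> real) \<Rightarrow> (complex \<Rightarrow> complex) \<Rightarrow> real" where
  "D_norm X M f = (\<Sum>n. sup_norm_on X (higher_deriv_on X n f) / M n)"

text \<open>
  On \<open>D_alg X M\<close>, \<open>D_norm\<close> is a seminorm whose kernel consists of the functions vanishing on
  \<open>X\<close>, so the following is completeness of the normed space of restrictions to \<open>X\<close>.
\<close>

definition D_complete :: "complex set \<Rightarrow> (nat \<Rightarrow> real) \<Rightarrow> bool" where
  "D_complete X M \<longleftrightarrow>
     (\<forall>F :: nat \<Rightarrow> complex \<Rightarrow> complex.
        (\<forall>k. F k \<in> D_alg X M) \<and>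
        (\<forall>e>0. \<exists>N. \<forall>j\<ge>N. \<forall>k\<ge>N. D_norm X M (\<lambda>z. F j z - F k z) < e) \<longrightarrow>
        (\<exists>f\<in>D_alg X M. (\<lambda>k. D_norm X M (\<lambda>z. F k z - f z)) \<longlonglongrightarrow> 0))"

definition good :: "complex set \<Rightarrow> bool" where
  "good X \<longleftrightarrow> (\<forall>M. weight_sequence M \<and> nonanalytic M \<longrightarrow> D_complete X M)"

definition induces_endomorphism ::
    "complex set \<Rightarrow> (nat \<Rightarrow> real) \<Rightarrow> (complex \<Rightarrow> complex) \<Rightarrow> bool" where
  "induces_endomorphism X M \<phi> \<longleftrightarrow> (\<forall>f\<in>D_alg X M. f \<circ> \<phi> \<in> D_alg X M)"

definition external_circular_tangent :: "complex set \<Rightarrow> complex \<Rightarrow> bool" where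
  "external_circular_tangent X c \<longleftrightarrow>
     (\<exists>w r. r > 0 \<and> ball w r \<subseteq> - X \<and> closure (ball w r) \<inter> X = {c})"

end

theory Submission
  imports Defs
begin

text \<open>
  Put \<open>c = \<phi> b\<close> and \<open>\<rho> = \<bar>\<phi>' b\<bar> > 1\<close>. For a point \<open>a\<close> at distance \<open>\<delta>\<close> from \<open>c\<close> on the radius of the
  external disc at \<open>c\<close>, the function \<open>1 / (z - a)\<close> has an \<open>n\<close>-th derivative of sup norm
  \<open>n! / \<delta> ^ (n + 1)\<close> on \<open>X\<close>, attained at \<open>c\<close>. By the chain rule for higher derivatives
  (\<open>higher_deriv_on_comp\<close>), the \<open>N\<close>-th derivative at \<open>b\<close> of its composite with \<open>\<phi>\<close> is, for small
  \<open>\<delta>\<close>, about \<open>\<rho> ^ N\<close> times as large.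

  The weights are \<open>M n = n! * R 1 * \<dots> * R n\<close> with \<open>R\<close> growing so fast, in terms of the derivatives
  of \<open>\<phi>\<close>, that \<open>M\<close> is a nonanalytic weight sequence and \<open>\<phi>\<close> lies in the algebra. For
  \<open>\<delta> = d N = 1 / (2 * R N)\<close> the norm of \<open>1 / (z - a)\<close> is comparable to its \<open>N\<close>-th term alone, so that
  a multiple \<open>g N\<close> has norm at most 3 and \<open>N\<close>-th term 1 (\<open>C_div_le\<close>, \<open>pole_sum_in_D_alg\<close>).

  The function \<open>f\<close> is the sum of \<open>\<rho> ^ (- k) * g k\<close> over even \<open>k\<close>. The series is Cauchy in norm, so
  its sum is in the algebra since \<open>X\<close> is good. For even \<open>N\<close> the term \<open>k = N\<close> contributes at least
  \<open>M N / 2\<close> to the \<open>N\<close>-th derivative of \<open>f \<circ> \<phi>\<close> at \<open>b\<close>, and the other terms together at most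
  \<open>M N / 4\<close> (\<open>linear_form_pole_sum_ge\<close>). Hence the terms of the norm series of \<open>f \<circ> \<phi>\<close> do not
  tend to 0, and \<open>f \<circ> \<phi>\<close> is not in the algebra.
\<close>

section \<open>Derivatives along a perfect compact set\<close>

lemma higher_deriv_on_eqI:
  assumes X: "perfect_compact X"
    and f: "\<And>z. z \<in> X \<Longrightarrow> f z = g 0 z"
    and g: "\<And>n z. z \<in> X \<Longrightarrow> (g n has_field_derivative g (Suc n) z) (at z within X)"
  shows "f \<in> D_infinity X" "\<And>n z. z \<in> X \<Longrightarrow> higher_deriv_on X n f z = g n z"
proof -
  have eq: "z \<in> X \<Longrightarrow> higher_deriv_on X n f z = g n z" for n z
  proof (induction n arbitrary: z)
    case 0
    then show ?case using f by simp
  next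
    case (Suc n)
    have "(higher_deriv_on X n f has_field_derivative g (Suc n) z) (at z within X)"
      using g[OF Suc.prems, of n] zero_less_one Suc.prems
      by (rule has_field_derivative_transform_within) (simp add: Suc.IH)
    then show ?case
      using X Suc.prems by (simp add: deriv_on_eqI perfect_compact_def)
  qed
  then show "\<And>n z. z \<in> X \<Longrightarrow> higher_deriv_on X n f z = g n z" .
  show "f \<in> D_infinity X"
    unfolding D_infinity_def field_differentiable_def
  proof safe
    fix n z assume z: "z \<in> X"
    have "(higher_deriv_on X n f has_field_derivative g (Suc n) z) (at z within X)"
      using g[OF z, of n] zero_less_one z
      by (rule has_field_derivative_transform_within) (simp add: eq)
    then show "\<exists>d. (higher_deriv_on X n f has_field_derivative d) (at z within X)" ..
  qed
qed

lemma higher_deriv_on_has_derivative: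
  assumes "perfect_compact X" "f \<in> D_infinity X" "z \<in> X"
  shows "(higher_deriv_on X n f has_field_derivative higher_deriv_on X (Suc n) f z) (at z within X)"
proof -
  obtain d where "(higher_deriv_on X n f has_field_derivative d) (at z within X)"
    using assms unfolding D_infinity_def field_differentiable_def by blast
  then show ?thesis
    using assms by (metis deriv_on_eqI perfect_compact_def higher_deriv_on.simps(2))
qed

lemma higher_deriv_on_diff:
  assumes "perfect_compact X" "f \<in> D_infinity X" "g \<in> D_infinity X"
  shows "(\<lambda>z. f z - g z) \<in> D_infinity X"
    and "\<And>n z. z \<in> X \<Longrightarrow>
      higher_deriv_on X n (\<lambda>z. f z - g z) z = higher_deriv_on X n f z - higher_deriv_on X n g z"
proof -
  let ?g = "\<lambda>n z. higher_deriv_on X n f z - higher_deriv_on X n g z"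
  have *: "(?g n has_field_derivative ?g (Suc n) z) (at z within X)"
    if "z \<in> X" for n z
    using assms that by (intro DERIV_diff higher_deriv_on_has_derivative)
  show "(\<lambda>z. f z - g z) \<in> D_infinity X"
    by (rule higher_deriv_on_eqI(1)[where g = ?g, OF assms(1) _ *]) auto
  show "\<And>n z. z \<in> X \<Longrightarrow>
      higher_deriv_on X n (\<lambda>z. f z - g z) z = higher_deriv_on X n f z - higher_deriv_on X n g z"
    by (rule higher_deriv_on_eqI(2)[where g = ?g, OF assms(1) _ *]) auto
qed

lemma sup_norm_on_leI:
  assumes "perfect_compact X" "\<And>z. z \<in> X \<Longrightarrow> cmod (f z) \<le> B"
  shows "sup_norm_on X f \<le> B"
  using assms unfolding sup_norm_on_def perfect_compact_def by (intro cSUP_least) auto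

lemma norm_higher_deriv_on_le_sup_norm:
  assumes "perfect_compact X" "f \<in> D_infinity X" "z \<in> X"
  shows "cmod (higher_deriv_on X n f z) \<le> sup_norm_on X (higher_deriv_on X n f)"
proof -
  have "continuous_on X (higher_deriv_on X n f)"
    using assms(2) unfolding D_infinity_def continuous_on_eq_continuous_within
    by (auto intro: field_differentiable_imp_continuous_at)
  then have "compact ((\<lambda>z. cmod (higher_deriv_on X n f z)) ` X)"
    using assms(1) unfolding perfect_compact_def
    by (intro compact_continuous_image continuous_intros) auto
  then have "bdd_above ((\<lambda>z. cmod (higher_deriv_on X n f z)) ` X)"
    by (intro bounded_imp_bdd_above compact_imp_bounded)
  then show ?thesis
    unfolding sup_norm_on_def using assms(3) by (intro cSUP_upper)
qed

lemma sup_norm_higher_deriv_on_nonneg: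
  assumes "perfect_compact X" "f \<in> D_infinity X"
  shows "0 \<le> sup_norm_on X (higher_deriv_on X n f)"
proof -
  obtain z where "z \<in> X" using assms(1) unfolding perfect_compact_def by auto
  from norm_higher_deriv_on_le_sup_norm[OF assms this] show ?thesis
    by (meson norm_ge_zero order_trans)
qed

lemma D_alg_diff:
  assumes X: "perfect_compact X" and M: "\<And>n. 0 < M n" and f: "f \<in> D_alg X M" and g: "g \<in> D_alg X M"
  shows "(\<lambda>z. f z - g z) \<in> D_alg X M"
proof -
  have fg: "f \<in> D_infinity X" "g \<in> D_infinity X"
    using f g by (auto simp: D_alg_def)
  note diff = higher_deriv_on_diff[OF X fg]
  have "summable (\<lambda>n. sup_norm_on X (higher_deriv_on X n f) / M n
      + sup_norm_on X (higher_deriv_on X n g) / M n)"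
    using f g by (intro summable_add) (auto simp: D_alg_def)
  then have "summable (\<lambda>n. sup_norm_on X (higher_deriv_on X n (\<lambda>z. f z - g z)) / M n)"
  proof (rule summable_comparison_test')
    fix n :: nat
    have "sup_norm_on X (higher_deriv_on X n (\<lambda>z. f z - g z))
        \<le> sup_norm_on X (higher_deriv_on X n f) + sup_norm_on X (higher_deriv_on X n g)"
    proof (rule sup_norm_on_leI[OF X])
      fix z assume z: "z \<in> X"
      show "cmod (higher_deriv_on X n (\<lambda>z. f z - g z) z)
          \<le> sup_norm_on X (higher_deriv_on X n f) + sup_norm_on X (higher_deriv_on X n g)"
        unfolding diff(2)[OF z]
        using norm_higher_deriv_on_le_sup_norm[OF X fg(1) z, of n]
          norm_higher_deriv_on_le_sup_norm[OF X fg(2) z, of n]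
          norm_triangle_ineq4[of "higher_deriv_on X n f z" "higher_deriv_on X n g z"] by linarith
    qed
    then show "norm (sup_norm_on X (higher_deriv_on X n (\<lambda>z. f z - g z)) / M n)
        \<le> sup_norm_on X (higher_deriv_on X n f) / M n + sup_norm_on X (higher_deriv_on X n g) / M n"
      using M[of n] sup_norm_higher_deriv_on_nonneg[OF X diff(1), of n]
      by (simp add: divide_right_mono flip: add_divide_distrib)
  qed
  with diff(1) show ?thesis by (simp add: D_alg_def)
qed

lemma norm_higher_deriv_on_le_D_norm:
  assumes X: "perfect_compact X" and M: "\<And>n. 0 < M n" and f: "f \<in> D_alg X M" and z: "z \<in> X"
  shows "cmod (higher_deriv_on X n f z) \<le> M n * D_norm X M f"
proof -
  have fD: "f \<in> D_infinity X" and s: "summable (\<lambda>n. sup_norm_on X (higher_deriv_on X n f) / M n)"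
    using f by (auto simp: D_alg_def)
  have "sum (\<lambda>n. sup_norm_on X (higher_deriv_on X n f) / M n) {n} \<le> D_norm X M f"
    unfolding D_norm_def using s
    by (rule sum_le_suminf)
       (use M sup_norm_higher_deriv_on_nonneg[OF X fD] in \<open>auto intro!: divide_nonneg_pos\<close>)
  then have "sup_norm_on X (higher_deriv_on X n f) \<le> M n * D_norm X M f"
    using M[of n] by (simp add: field_simps)
  with norm_higher_deriv_on_le_sup_norm[OF X fD z, of n] show ?thesis by linarith
qed

section \<open>Derivatives of a composition\<close>

text \<open>
  The polynomials with complex coefficients in \<open>\<phi>'\<close>, \<open>\<phi>''\<close>, and so on, as functions. They are
  closed under differentiation along \<open>X\<close>, which is all that is needed of the coefficients in the
  chain rule for higher derivatives.
\<close>

inductive_set deriv_polys :: "complex set \<Rightarrow> (complex \<Rightarrow> complex) \<Rightarrow> (complex \<Rightarrow> complex) set"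
  for X :: "complex set" and \<phi> :: "complex \<Rightarrow> complex" where
  deriv: "higher_deriv_on X (Suc i) \<phi> \<in> deriv_polys X \<phi>"
| const: "(\<lambda>z. k) \<in> deriv_polys X \<phi>"
| add: "p \<in> deriv_polys X \<phi> \<Longrightarrow> q \<in> deriv_polys X \<phi> \<Longrightarrow> (\<lambda>z. p z + q z) \<in> deriv_polys X \<phi>"
| mult: "p \<in> deriv_polys X \<phi> \<Longrightarrow> q \<in> deriv_polys X \<phi> \<Longrightarrow> (\<lambda>z. p z * q z) \<in> deriv_polys X \<phi>"

lemma deriv_polys_closed_deriv:
  assumes X: "perfect_compact X" and \<phi>: "\<phi> \<in> D_infinity X" and p: "p \<in> deriv_polys X \<phi>"
  shows "\<exists>p'\<in>deriv_polys X \<phi>. \<forall>z\<in>X. (p has_field_derivative p' z) (at z within X)"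
  using p
proof induction
  case (deriv i)
  show ?case
    using higher_deriv_on_has_derivative[OF X \<phi>] deriv_polys.deriv by blast
next
  case (const k)
  show ?case
    by (rule bexI[of _ "\<lambda>z. 0"]) (auto intro: deriv_polys.const)
next
  case (add p q)
  then obtain p' q' where "p' \<in> deriv_polys X \<phi>" "q' \<in> deriv_polys X \<phi>"
    "\<forall>z\<in>X. (p has_field_derivative p' z) (at z within X)"
    "\<forall>z\<in>X. (q has_field_derivative q' z) (at z within X)" by blast
  then show ?case
    by (intro bexI[of _ "\<lambda>z. p' z + q' z"]) (auto intro: deriv_polys.add DERIV_add)
next
  case (mult p q)
  then obtain p' q' where "p' \<in> deriv_polys X \<phi>" "q' \<in> deriv_polys X \<phi>"
    "\<forall>z\<in>X. (p has_field_derivative p' z) (at z within X)"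
    "\<forall>z\<in>X. (q has_field_derivative q' z) (at z within X)" by blast
  with mult.hyps show ?case
    by (intro bexI[of _ "\<lambda>z. p z * q' z + p' z * q z"])
       (auto intro!: deriv_polys.add deriv_polys.mult DERIV_mult')
qed

text \<open>
  A form of the formula of Faa di Bruno that only records the leading coefficient: the \<open>n\<close>-th
  derivative of \<open>f \<circ> \<phi>\<close> is a combination of the derivatives of \<open>f\<close> at \<open>\<phi> z\<close> up to order \<open>n\<close>,
  with coefficients that do not depend on \<open>f\<close> and with leading coefficient \<open>\<phi>' ^ n\<close>.
\<close>

lemma higher_deriv_on_comp:
  assumes X: "perfect_compact X" and \<phi>: "\<phi> \<in> D_infinity X" and img: "\<phi> ` X \<subseteq> X"
  shows "\<exists>\<beta>. (\<forall>j. \<beta> j \<in> deriv_polys X \<phi>) \<and> (\<forall>z. \<beta> n z = deriv_on X \<phi> z ^ n) \<and>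
    (\<forall>f\<in>D_infinity X. \<forall>z\<in>X.
      higher_deriv_on X n (f \<circ> \<phi>) z = (\<Sum>j\<le>n. \<beta> j z * higher_deriv_on X j f (\<phi> z)))"
proof (induction n)
  case 0
  show ?case
    by (rule exI[of _ "\<lambda>j z. 1"]) (auto intro: deriv_polys.const)
next
  case (Suc n)
  then obtain \<beta> where \<beta>: "\<And>j. \<beta> j \<in> deriv_polys X \<phi>" "\<And>z. \<beta> n z = deriv_on X \<phi> z ^ n"
    and eq: "\<And>f z. f \<in> D_infinity X \<Longrightarrow> z \<in> X \<Longrightarrow>
      higher_deriv_on X n (f \<circ> \<phi>) z = (\<Sum>j\<le>n. \<beta> j z * higher_deriv_on X j f (\<phi> z))"
    by blast
  have "\<forall>j. \<exists>p'. p' \<in> deriv_polys X \<phi> \<and> (\<forall>z\<in>X. (\<beta> j has_field_derivative p' z) (at z within X))"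
    using deriv_polys_closed_deriv[OF X \<phi> \<beta>(1)] by blast
  then obtain \<beta>' where \<beta>': "\<And>j. \<beta>' j \<in> deriv_polys X \<phi>"
    and d\<beta>: "\<And>j z. z \<in> X \<Longrightarrow> (\<beta> j has_field_derivative \<beta>' j z) (at z within X)"
    by metis
  define \<gamma> where "\<gamma> = (\<lambda>j z. (if j \<le> n then \<beta>' j z else 0) +
    (if j = 0 then 0 else \<beta> (j - 1) z * deriv_on X \<phi> z))"
  have \<phi>': "deriv_on X \<phi> \<in> deriv_polys X \<phi>"
    using deriv_polys.deriv[of X 0 \<phi>] by simp
  have "\<gamma> j \<in> deriv_polys X \<phi>" for j
  proof -
    have "(\<lambda>z. if j \<le> n then \<beta>' j z else 0) \<in> deriv_polys X \<phi>"
      using \<beta>' deriv_polys.const by (cases "j \<le> n") auto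
    moreover have "(\<lambda>z. if j = 0 then 0 else \<beta> (j - 1) z * deriv_on X \<phi> z) \<in> deriv_polys X \<phi>"
      using \<beta>(1) \<phi>' deriv_polys.const deriv_polys.mult by (cases "j = 0") auto
    ultimately show ?thesis unfolding \<gamma>_def by (rule deriv_polys.add)
  qed
  moreover have "\<gamma> (Suc n) z = deriv_on X \<phi> z ^ Suc n" for z
    by (simp add: \<gamma>_def \<beta>(2))
  moreover have "higher_deriv_on X (Suc n) (f \<circ> \<phi>) z
      = (\<Sum>j\<le>Suc n. \<gamma> j z * higher_deriv_on X j f (\<phi> z))"
    if f: "f \<in> D_infinity X" and z: "z \<in> X" for f z
  proof -
    let ?F = "\<lambda>j. higher_deriv_on X j f (\<phi> z)"
    have "((\<lambda>z. higher_deriv_on X j f (\<phi> z)) has_field_derivative ?F (Suc j) * deriv_on X \<phi> z)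
        (at z within X)" for j
    proof -
      have "(higher_deriv_on X j f has_field_derivative ?F (Suc j)) (at (\<phi> z) within \<phi> ` X)"
        using higher_deriv_on_has_derivative[OF X f] z img
        by (blast intro: has_field_derivative_subset)
      from DERIV_image_chain[OF this, of "deriv_on X \<phi> z"]
      show ?thesis
        using higher_deriv_on_has_derivative[OF X \<phi> z, of 0] by (simp add: o_def)
    qed
    then have "((\<lambda>z. \<Sum>j\<le>n. \<beta> j z * higher_deriv_on X j f (\<phi> z)) has_field_derivative
        (\<Sum>j\<le>n. \<beta> j z * (?F (Suc j) * deriv_on X \<phi> z) + \<beta>' j z * ?F j)) (at z within X)"
      by (intro DERIV_sum DERIV_mult' d\<beta> z)
    then have "(higher_deriv_on X n (f \<circ> \<phi>) has_field_derivative
        (\<Sum>j\<le>n. \<beta> j z * (?F (Suc j) * deriv_on X \<phi> z) + \<beta>' j z * ?F j)) (at z within X)"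
      using zero_less_one z by (rule has_field_derivative_transform_within) (simp add: eq[OF f])
    then have "higher_deriv_on X (Suc n) (f \<circ> \<phi>) z
        = (\<Sum>j\<le>n. \<beta> j z * (?F (Suc j) * deriv_on X \<phi> z) + \<beta>' j z * ?F j)"
      using X z by (simp add: deriv_on_eqI perfect_compact_def)
    also have "\<dots> = (\<Sum>j\<le>n. \<beta>' j z * ?F j) + (\<Sum>j\<le>n. \<beta> j z * deriv_on X \<phi> z * ?F (Suc j))"
      by (simp add: sum.distrib algebra_simps)
    also have "(\<Sum>j\<le>n. \<beta> j z * deriv_on X \<phi> z * ?F (Suc j))
        = (\<Sum>j\<le>Suc n. (if j = 0 then 0 else \<beta> (j - 1) z * deriv_on X \<phi> z) * ?F j)"
      by (subst sum.atMost_Suc_shift) simp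
    also have "(\<Sum>j\<le>n. \<beta>' j z * ?F j) = (\<Sum>j\<le>Suc n. (if j \<le> n then \<beta>' j z else 0) * ?F j)"
      by simp
    finally show ?thesis
      by (simp only: \<gamma>_def distrib_right sum.distrib)
  qed
  ultimately show ?case by blast
qed

section \<open>Sums of simple poles\<close>

lemma higher_deriv_on_pole_sum:
  assumes X: "perfect_compact X" and a: "\<And>k. k \<in> I \<Longrightarrow> a k \<notin> X"
    and f: "\<And>z. z \<in> X \<Longrightarrow> f z = (\<Sum>k\<in>I. s k / (z - a k))"
  shows "f \<in> D_infinity X"
    and "\<And>n z. z \<in> X \<Longrightarrow>
      higher_deriv_on X n f z = (\<Sum>k\<in>I. s k * ((- 1) ^ n * fact n / (z - a k) ^ Suc n))"
proof -
  let ?g = "\<lambda>n z. \<Sum>k\<in>I. s k * ((- 1) ^ n * fact n / (z - a k) ^ Suc n)"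
  have d: "(?g n has_field_derivative ?g (Suc n) z) (at z within X)" if z: "z \<in> X" for n z
  proof (rule DERIV_sum, rule DERIV_cmult)
    fix k assume "k \<in> I"
    then have nz: "z - a k \<noteq> 0" using a z by auto
    have quotient: "((- 1) ^ n * fact n * - (of_nat (Suc n) * w ^ n)) / (w ^ Suc n * w ^ Suc n)
        = (- 1) ^ Suc n * fact (Suc n) / w ^ Suc (Suc n)" if "w \<noteq> 0" for w :: complex
      using that by (simp add: field_simps)
    have "((\<lambda>z. (- 1) ^ n * fact n / (z - a k) ^ Suc n) has_field_derivative
        ((- 1) ^ n * fact n * - (of_nat (Suc n) * (z - a k) ^ n)) /
          ((z - a k) ^ Suc n * (z - a k) ^ Suc n)) (at z within X)"
      using nz by (auto intro!: derivative_eq_intros simp del: power_Suc)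
    then show "((\<lambda>z. (- 1) ^ n * fact n / (z - a k) ^ Suc n) has_field_derivative
        (- 1) ^ Suc n * fact (Suc n) / (z - a k) ^ Suc (Suc n)) (at z within X)"
      unfolding quotient[OF nz] .
  qed
  show "f \<in> D_infinity X"
    by (rule higher_deriv_on_eqI(1)[where g = ?g, OF X _ d]) (auto simp: f)
  show "\<And>n z. z \<in> X \<Longrightarrow> higher_deriv_on X n f z = ?g n z"
    by (rule higher_deriv_on_eqI(2)[where g = ?g, OF X _ d]) (auto simp: f)
qed

section \<open>Rapidly growing weights\<close>

text \<open>
  The sequence \<open>R\<close> of quotients of consecutive weights, up to factorials. The sequence \<open>A\<close> is a
  lower bound that can be prescribed in advance; \<open>R (Suc n)\<close> moreover dominates a high power
  of \<open>R n\<close>, hence every expression in the earlier members that occurs below. The value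
  \<open>R 0\<close> does not enter the weights and only serves to define \<open>d 0\<close>.
\<close>

locale rapid_growth =
  fixes A R :: "nat \<Rightarrow> real"
  assumes A_ge: "8 * 2 ^ n \<le> A n"
    and R_ge: "A n \<le> R n"
    and R_Suc_ge: "A (Suc n) * (2 * R n) ^ Suc n \<le> R (Suc n)"
begin

text \<open>The weights divided by the factorials.\<close>

definition P :: "nat \<Rightarrow> real" where "P n = (\<Prod>i=1..n. R i)"

definition weight :: "nat \<Rightarrow> real" where "weight n = fact n * P n"

text \<open>The distance of the \<open>k\<close>-th pole from the boundary point \<open>c\<close>.\<close>

definition d :: "nat \<Rightarrow> real" where "d k = 1 / (2 * R k)"

lemma A_ge_8: "8 \<le> A n"
  using A_ge[of n] one_le_power[of "2::real" n] by linarith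

lemma R_ge_8: "8 \<le> R n"
  using A_ge_8[of n] R_ge[of n] by linarith

lemma R_pos: "0 < R n" using R_ge_8[of n] by linarith

lemma d_pos: "0 < d k" using R_pos[of k] by (simp add: d_def)

lemma d_le_1: "d k \<le> 1" using R_ge_8[of k] by (simp add: d_def)

lemma P_0: "P 0 = 1" by (simp add: P_def)

lemma P_Suc: "P (Suc n) = P n * R (Suc n)"
  by (simp add: P_def)

lemma P_ge_1: "1 \<le> P n"
proof (induction n)
  case (Suc n)
  then have "1 * 1 \<le> P n * R (Suc n)"
    using R_ge_8[of "Suc n"] by (intro mult_mono) auto
  then show ?case by (simp add: P_Suc)
qed (simp add: P_0)

lemma P_pos: "0 < P n" using P_ge_1[of n] by linarith

lemma weight_pos: "0 < weight n" using P_pos by (simp add: weight_def)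

lemma R_Suc_ge4: "4 * R n \<le> R (Suc n)"
proof -
  have "4 * R n \<le> 8 * (2 * R n) ^ 1" using R_pos[of n] by simp
  also have "\<dots> \<le> A (Suc n) * (2 * R n) ^ Suc n"
    using A_ge_8[of "Suc n"] R_ge_8[of n] by (intro mult_mono power_increasing) auto
  finally show ?thesis using R_Suc_ge[of n] by linarith
qed

lemma R_mono: "m \<le> n \<Longrightarrow> R m \<le> R n"
proof (rule lift_Suc_mono_le)
  show "R n \<le> R (Suc n)" for n using R_Suc_ge4[of n] R_pos[of n] by linarith
qed

lemma P_mono: "m \<le> n \<Longrightarrow> P m \<le> P n"
proof (rule lift_Suc_mono_le)
  show "P n \<le> P (Suc n)" for n
    using mult_left_mono[of 1 "R (Suc n)" "P n"] R_ge_8[of "Suc n"] P_pos[of n]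
    by (simp add: P_Suc)
qed

lemma P_add_ge: "P m * P n \<le> P (m + n)"
proof (induction n)
  case (Suc n)
  have "(P m * P n) * R (Suc n) \<le> P (m + n) * R (Suc (m + n))"
    using Suc R_mono[of "Suc n" "Suc (m + n)"] R_pos[of "Suc n"] P_pos[of "m + n"]
    by (intro mult_mono) auto
  then show ?case by (simp add: P_Suc mult.assoc)
qed (simp add: P_0)

lemma P_add_le: "P (n + m) \<le> P n * R (n + m) ^ m"
proof (induction m)
  case (Suc m)
  have "P (n + Suc m) = P (n + m) * R (n + Suc m)" by (simp add: P_Suc)
  also have "\<dots> \<le> (P n * R (n + Suc m) ^ m) * R (n + Suc m)"
  proof (rule mult_right_mono)
    have "P n * R (n + m) ^ m \<le> P n * R (n + Suc m) ^ m"
      using R_mono[of "n + m" "n + Suc m"] R_pos[of "n + m"] P_pos[of n]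
      by (intro mult_left_mono power_mono) auto
    with Suc show "P (n + m) \<le> P n * R (n + Suc m) ^ m" by linarith
  qed (use R_pos[of "n + Suc m"] in simp)
  finally show ?case by (simp add: mult_ac)
qed simp

lemma P_add_ge_power: "P k * (4 * R k) ^ m \<le> P (k + m)"
proof (induction m)
  case (Suc m)
  have "4 * R k \<le> R (Suc (k + m))"
    using R_mono[of k "k + m"] R_Suc_ge4[of "k + m"] by linarith
  then have "(P k * (4 * R k) ^ m) * (4 * R k) \<le> P (k + m) * R (Suc (k + m))"
    using Suc R_pos[of k] P_pos[of "k + m"] by (intro mult_mono) auto
  then show ?case by (simp add: P_Suc mult_ac)
qed simp

lemma R_Suc_ge_P: "A (Suc n) * P n \<le> R (Suc n)"
proof -
  have "P n \<le> R n ^ n" using P_add_le[of 0 n] by (simp add: P_0)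
  also have "\<dots> \<le> (2 * R n) ^ n" using R_pos[of n] by (intro power_mono) auto
  also have "\<dots> \<le> (2 * R n) ^ Suc n" using R_ge_8[of n] by (intro power_increasing) auto
  finally have "A (Suc n) * P n \<le> A (Suc n) * (2 * R n) ^ Suc n"
    using A_ge_8[of "Suc n"] by (intro mult_left_mono) auto
  with R_Suc_ge[of n] show ?thesis by linarith
qed

lemma weight_sequence: "weight_sequence weight"
proof -
  have "real ((m + n) choose n) \<le> weight (m + n) / (weight m * weight n)" for m n
  proof -
    have "real ((m + n) choose n) = fact (m + n) / (fact m * fact n)"
      by (simp add: binomial_fact)
    also have "\<dots> = fact (m + n) * (P m * P n) / (weight m * weight n)"
      using P_pos[of m] P_pos[of n] by (simp add: weight_def)
    also have "\<dots> \<le> fact (m + n) * P (m + n) / (weight m * weight n)"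
      using P_add_ge[of m n] weight_pos[of m] weight_pos[of n]
      by (intro divide_right_mono mult_left_mono) auto
    finally show ?thesis by (simp add: weight_def)
  qed
  then show ?thesis
    unfolding weight_sequence_def using weight_pos by (simp add: weight_def P_0)
qed

lemma nonanalytic: "nonanalytic weight"
proof -
  have bound: "norm (root (Suc n) (fact (Suc n) / weight (Suc n))) \<le> (1/2) ^ n" for n
  proof -
    have "(2 ^ n) ^ Suc n \<le> (2 * R n) ^ Suc n"
      using A_ge[of n] R_ge[of n] zero_less_power[of "2::real" n]
      by (intro power_mono) linarith+
    also have "\<dots> \<le> A (Suc n) * (2 * R n) ^ Suc n"
      using A_ge_8[of "Suc n"] R_pos[of n] by simp
    also have "\<dots> \<le> R (Suc n)" by (rule R_Suc_ge)
    also have "\<dots> \<le> P (Suc n)"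
      using P_ge_1[of n] R_pos[of "Suc n"] by (simp add: P_Suc)
    finally have *: "(2 ^ n) ^ Suc n \<le> P (Suc n)" .
    have "fact (Suc n) / weight (Suc n) = 1 / P (Suc n)"
      unfolding weight_def by (simp del: fact_Suc)
    also have "\<dots> \<le> 1 / (2 ^ n) ^ Suc n"
      using * by (intro divide_left_mono mult_pos_pos P_pos) auto
    finally have "root (Suc n) (fact (Suc n) / weight (Suc n)) \<le> root (Suc n) (((1/2) ^ n) ^ Suc n)"
      by (simp only: power_one_over real_root_le_iff zero_less_Suc)
    also have "\<dots> = (1/2) ^ n" by (rule real_root_power_cancel) auto
    finally show ?thesis
      using weight_pos[of "Suc n"] by (simp add: less_imp_le)
  qed
  have "(\<lambda>n. root (Suc n) (fact (Suc n) / weight (Suc n))) \<longlonglongrightarrow> 0"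
    by (rule tendsto_0_le[OF LIMSEQ_power_zero[of "1/2::real"], of _ 1])
       (use bound in \<open>auto simp del: fact_Suc\<close>)
  then show ?thesis
    unfolding nonanalytic_def by (rule LIMSEQ_imp_Suc)
qed

text \<open>
  The coefficient of the pole at distance \<open>d k\<close> from \<open>X\<close>: it makes the \<open>k\<close>-th term of the norm of
  the function \<open>C k / (z - a k)\<close> on \<open>X\<close> equal to one.
\<close>

definition C :: "nat \<Rightarrow> real" where "C k = P k * d k ^ Suc k"

lemma C_pos: "0 < C k"
  using P_pos d_pos by (simp add: C_def)

text \<open>
  The left-hand side is the \<open>n\<close>-th term of the norm of \<open>C k / (z - a k)\<close>, for a pole at distance
  \<open>d k\<close> from \<open>X\<close>. As \<open>1 / d k\<close> exceeds
  \<open>R 0, \<dots>, R k\<close> by a factor of at least 2 and is at most half of each of the later \<open>R i\<close>, the terms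
  decay geometrically on both sides of \<open>n = k\<close>. The subtractions are truncated, so at most
  one of the two factors on the right differs from 1.
\<close>

lemma C_div_le: "C k / (d k ^ Suc n * P n) \<le> (1/2) ^ (n - k) * (1/2) ^ (k - n)"
proof (cases "n \<le> k")
  case True
  then obtain m where m: "k = n + m" using le_Suc_ex by blast
  have "C k / (d k ^ Suc n * P n) = P k * d k ^ m / P n"
    using d_pos[of k] unfolding C_def m by (simp add: power_add)
  also have "\<dots> \<le> P n * R k ^ m * d k ^ m / P n"
    using P_add_le[of n m] d_pos[of k] P_pos[of n] unfolding m
    by (intro divide_right_mono mult_right_mono) auto
  also have "\<dots> = (R k * d k) ^ m"
    using P_pos[of n] by (simp add: power_mult_distrib)
  also have "R k * d k = 1/2" using R_pos[of k] by (simp add: d_def)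
  finally show ?thesis using m by simp
next
  case False
  then obtain m where m: "n = k + m" using le_Suc_ex by (metis nat_le_linear)
  have "C k / (d k ^ Suc n * P n) = P k / (d k ^ m * P n)"
    using d_pos[of k] unfolding C_def m by (simp add: power_add)
  also have "\<dots> \<le> P k / (d k ^ m * (P k * (4 * R k) ^ m))"
    using P_add_ge_power[of k m] d_pos[of k] P_pos[of n] P_pos[of k] R_pos[of k] unfolding m
    by (intro divide_left_mono mult_left_mono mult_pos_pos) auto
  also have "\<dots> = 1 / (d k * (4 * R k)) ^ m"
    using P_pos[of k] by (simp add: power_mult_distrib)
  also have "d k * (4 * R k) = 2" using R_pos[of k] by (simp add: d_def)
  finally show ?thesis using m by (simp add: power_one_over)
qed

lemma suminf_two_sided_geometric:
  shows "summable (\<lambda>n. (1/2::real) ^ (n - k) * (1/2) ^ (k - n))"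
    and "(\<Sum>n. (1/2::real) ^ (n - k) * (1/2) ^ (k - n)) \<le> 3"
proof -
  let ?t = "\<lambda>n. (1/2::real) ^ (n - k) * (1/2) ^ (k - n)"
  have shift: "(\<lambda>n. ?t (n + k)) = (\<lambda>n. (1/2) ^ n)" by auto
  then have "summable (\<lambda>n. ?t (n + k))" by (simp only: shift) (rule summable_geometric, simp)
  then show s: "summable ?t" by (rule summable_iff_shift[THEN iffD1])
  have "(\<Sum>n. ?t n) = (\<Sum>n. ?t (n + k)) + (\<Sum>n<k. ?t n)"
    by (rule suminf_split_initial_segment[OF s])
  also have "(\<Sum>n. ?t (n + k)) = 2"
    unfolding shift using suminf_geometric[of "1/2::real"] by simp
  also have "(\<Sum>n<k. ?t n) = (\<Sum>n<k. (1/2) ^ (k - n))" by (rule sum.cong) auto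
  also have "\<dots> \<le> 1"
  proof (induction k)
    case (Suc k)
    have "(\<Sum>n<Suc k. (1/2::real) ^ (Suc k - n)) = (\<Sum>n<k. (1/2) * (1/2) ^ (k - n)) + 1/2"
      by (simp add: Suc_diff_le)
    also have "\<dots> = (1/2) * (\<Sum>n<k. (1/2) ^ (k - n)) + 1/2"
      by (simp add: sum_distrib_left)
    finally show ?case using Suc by simp
  qed simp
  finally show "suminf ?t \<le> 3" by simp
qed

text \<open>
  The estimate of the norm does not depend on the indices in \<open>I\<close>, so summable coefficients give
  Cauchy series.
\<close>

lemma pole_sum_in_D_alg:
  fixes s a :: "nat \<Rightarrow> complex" and f :: "complex \<Rightarrow> complex"
  assumes X: "perfect_compact X"
    and dist: "\<And>k z. k \<in> I \<Longrightarrow> z \<in> X \<Longrightarrow> d k \<le> cmod (z - a k)"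
    and f: "\<And>z. z \<in> X \<Longrightarrow> f z = (\<Sum>k\<in>I. s k * C k / (z - a k))"
  shows "f \<in> D_alg X weight" "D_norm X weight f \<le> 3 * (\<Sum>k\<in>I. cmod (s k))"
proof -
  have notin: "a k \<notin> X" if "k \<in> I" for k
    using dist[OF that, of "a k"] d_pos[of k] by auto
  have deriv: "f \<in> D_infinity X"
    "\<And>n z. z \<in> X \<Longrightarrow> higher_deriv_on X n f z
      = (\<Sum>k\<in>I. s k * C k * ((- 1) ^ n * fact n / (z - a k) ^ Suc n))"
    by (rule higher_deriv_on_pole_sum[OF X notin f]; assumption)+
  let ?t = "\<lambda>k n. (1/2::real) ^ (n - k) * (1/2) ^ (k - n)"
  let ?g = "\<lambda>n. \<Sum>k\<in>I. cmod (s k) * ?t k n"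
  have bound: "sup_norm_on X (higher_deriv_on X n f) / weight n \<le> ?g n" for n
  proof -
    have "sup_norm_on X (higher_deriv_on X n f)
        \<le> (\<Sum>k\<in>I. cmod (s k) * (C k * fact n / d k ^ Suc n))"
    proof (rule sup_norm_on_leI[OF X])
      fix z assume z: "z \<in> X"
      show "cmod (higher_deriv_on X n f z) \<le> (\<Sum>k\<in>I. cmod (s k) * (C k * fact n / d k ^ Suc n))"
        unfolding deriv(2)[OF z]
      proof (rule sum_norm_le)
        fix k assume k: "k \<in> I"
        have "cmod (s k * C k * ((- 1) ^ n * fact n / (z - a k) ^ Suc n))
            = cmod (s k) * (C k * fact n / cmod (z - a k) ^ Suc n)"
          using C_pos[of k] by (simp add: norm_mult norm_divide norm_power del: power_Suc)
        also have "\<dots> \<le> cmod (s k) * (C k * fact n / d k ^ Suc n)"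
          using dist[OF k z] d_pos[of k] C_pos[of k]
          by (intro mult_left_mono divide_left_mono power_mono mult_pos_pos zero_less_power) auto
        finally show "cmod (s k * C k * ((- 1) ^ n * fact n / (z - a k) ^ Suc n))
            \<le> cmod (s k) * (C k * fact n / d k ^ Suc n)" .
      qed
    qed
    then have "sup_norm_on X (higher_deriv_on X n f) / weight n
        \<le> (\<Sum>k\<in>I. cmod (s k) * (C k * fact n / d k ^ Suc n)) / weight n"
      using weight_pos[of n] by (intro divide_right_mono) auto
    also have "\<dots> = (\<Sum>k\<in>I. cmod (s k) * (C k / (d k ^ Suc n * P n)))"
      by (simp add: sum_divide_distrib weight_def del: power_Suc)
    also have "\<dots> \<le> ?g n"
      by (intro sum_mono mult_left_mono C_div_le) auto
    finally show ?thesis .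
  qed
  have g: "summable ?g"
    by (rule summable_sum, rule summable_mult, rule suminf_two_sided_geometric(1))
  have s: "summable (\<lambda>n. sup_norm_on X (higher_deriv_on X n f) / weight n)"
    using g
  proof (rule summable_comparison_test')
    show "norm (sup_norm_on X (higher_deriv_on X n f) / weight n) \<le> ?g n" for n
      using bound[of n] sup_norm_higher_deriv_on_nonneg[OF X deriv(1), of n] weight_pos[of n]
      by simp
  qed
  with deriv(1) show "f \<in> D_alg X weight" by (simp add: D_alg_def)
  have "D_norm X weight f \<le> suminf ?g"
    unfolding D_norm_def by (rule suminf_le[OF bound s g])
  also have "\<dots> = (\<Sum>k\<in>I. \<Sum>n. cmod (s k) * ?t k n)"
    by (rule suminf_sum, rule summable_mult, rule suminf_two_sided_geometric(1))
  also have "\<dots> = (\<Sum>k\<in>I. cmod (s k) * (\<Sum>n. ?t k n))"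
    by (rule sum.cong[OF refl], rule suminf_mult, rule suminf_two_sided_geometric(1))
  also have "\<dots> \<le> (\<Sum>k\<in>I. cmod (s k) * 3)"
    by (rule sum_mono, rule mult_left_mono, rule suminf_two_sided_geometric(2)) simp
  finally show "D_norm X weight f \<le> 3 * (\<Sum>k\<in>I. cmod (s k))"
    by (simp add: sum_distrib_left mult.commute)
qed

text \<open>
  A gliding hump argument. A linear form \<open>\<Sum>j\<le>N. \<beta> j * f\<^sup>(\<^sup>j\<^sup>) c\<close> is applied to the sums of poles at the
  points \<open>a k\<close> with coefficients \<open>e k * C k\<close>. The pole of index \<open>N\<close> contributes at least
  \<open>weight N / 2\<close>, through the derivative of highest order. The poles of lower index do
  not depend on \<open>R N\<close>, so \<open>weight N\<close> is much larger than their contribution, and those of index \<open>k \<ge> N + 2\<close> have small derivatives up to order \<open>N\<close>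
  because \<open>C k\<close> contains the factor \<open>d k ^ Suc k\<close>. The pole of index \<open>N + 1\<close> would contribute
  with the same order of magnitude as the main term; it is excluded by \<open>e (Suc N) = 0\<close>.
\<close>

lemma linear_form_pole_sum_ge:
  fixes \<beta> a :: "nat \<Rightarrow> complex" and e :: "nat \<Rightarrow> real"
  assumes dist: "\<And>k. cmod (c - a k) = d k"
    and B: "\<And>k. N \<le> k \<Longrightarrow> 8 * 2 ^ k * (\<Sum>j\<le>N. cmod (\<beta> j) * fact j) \<le> A k"
    and lead: "1 \<le> cmod (\<beta> N)"
    and e: "\<And>k. 0 \<le> e k" "\<And>k. e k \<le> 1" "e (Suc N) = 0" "e N * cmod (\<beta> N) = 1"
    and NK: "N < K"
  shows "weight N / 4 \<le>
    cmod (\<Sum>j\<le>N. \<beta> j * (\<Sum>k<K. e k * C k * ((- 1) ^ j * fact j / (c - a k) ^ Suc j)))"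
proof -
  define B0 where "B0 = (\<Sum>j\<le>N. cmod (\<beta> j) * fact j)"
  define \<tau> where "\<tau> k = (\<Sum>j\<le>N. \<beta> j * (C k * ((- 1) ^ j * fact j / (c - a k) ^ Suc j)))" for k
  have B0: "0 \<le> B0" unfolding B0_def by (intro sum_nonneg) auto
  have weight_ge_P: "P N \<le> weight N"
    using P_pos[of N] fact_ge_1[of N, where ?'a = real] by (simp add: weight_def)
  have norm_term: "cmod (\<beta> j * (C k * ((- 1) ^ j * fact j / (c - a k) ^ Suc j)))
      = cmod (\<beta> j) * fact j * (C k / d k ^ Suc j)" for j k
    using C_pos[of k] by (simp add: norm_mult norm_divide norm_power dist del: power_Suc)
  have \<tau>_le: "cmod (\<tau> k) \<le> B0 * b" if "\<And>j. j \<le> N \<Longrightarrow> C k / d k ^ Suc j \<le> b" for k b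
    unfolding \<tau>_def B0_def sum_distrib_right
  proof (rule sum_norm_le)
    fix j assume "j \<in> {..N}"
    then show "cmod (\<beta> j * (C k * ((- 1) ^ j * fact j / (c - a k) ^ Suc j)))
        \<le> cmod (\<beta> j) * fact j * b"
      unfolding norm_term by (intro mult_left_mono that) auto
  qed
  have early: "cmod (\<tau> k) \<le> weight N * (1/2) ^ N / 8" if k: "k < N" for k
  proof -
    obtain N' where N': "N = Suc N'" using k by (cases N) auto
    then have kN': "k \<le> N'" using k by simp
    have "cmod (\<tau> k) \<le> B0 * (P N' * (2 * R N') ^ N)"
    proof (rule \<tau>_le)
      fix j assume j: "j \<le> N"
      have "C k / d k ^ Suc j = P k * d k ^ k * (1 / d k) ^ j"
        using d_pos[of k] by (simp add: C_def power_one_over)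
      also have "\<dots> \<le> P N' * 1 * (1 / d k) ^ N"
        using d_pos[of k] d_le_1[of k] P_pos P_mono[OF kN'] j
        by (intro mult_mono power_increasing power_le_one) (auto simp: less_imp_le)
      also have "\<dots> \<le> P N' * (2 * R N') ^ N"
        using R_mono[OF kN'] R_pos[of k] P_pos[of N']
        by (auto simp: d_def intro!: mult_left_mono power_mono)
      finally show "C k / d k ^ Suc j \<le> P N' * (2 * R N') ^ N" .
    qed
    moreover have "8 * 2 ^ N * (B0 * (P N' * (2 * R N') ^ N)) \<le> weight N"
    proof -
      have "8 * 2 ^ N * B0 * (2 * R N') ^ N \<le> A N * (2 * R N') ^ N"
        using B[of N] R_pos[of N'] by (intro mult_right_mono) (auto simp: B0_def)
      also have "\<dots> \<le> R N" using R_Suc_ge[of N'] by (simp only: N')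
      finally have "P N' * (8 * 2 ^ N * B0 * (2 * R N') ^ N) \<le> P N' * R N"
        using P_pos[of N'] by (intro mult_left_mono) auto
      then show ?thesis using weight_ge_P by (simp add: N' P_Suc mult_ac)
    qed
    ultimately have "8 * 2 ^ N * cmod (\<tau> k) \<le> weight N"
      by (meson mult_left_mono order_trans zero_le_mult_iff zero_le_numeral zero_le_power)
    then show ?thesis by (simp add: field_simps power_one_over)
  qed
  have late: "cmod (\<tau> k) \<le> weight N * (1/2) ^ k / 8" if k: "N + 2 \<le> k" for k
  proof -
    obtain k' where k': "k = Suc k'" using k by (cases k) auto
    have "cmod (\<tau> k) \<le> B0 * (1 / A k)"
    proof (rule \<tau>_le)
      fix j assume j: "j \<le> N"
      define i where "i = k - j"
      have i: "k = j + i" "2 \<le> i" using j k by (auto simp: i_def)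
      have "C k / d k ^ Suc j = P k * d k ^ i"
        using d_pos[of k] unfolding C_def i(1) by (simp add: power_add)
      also have "\<dots> \<le> P k * d k ^ 2"
        using d_pos[of k] d_le_1[of k] P_pos[of k] i(2)
        by (intro mult_left_mono power_decreasing) auto
      also have "\<dots> = P k' / (4 * R k)"
        using R_pos[of k] by (simp add: k' P_Suc d_def power2_eq_square)
      also have "\<dots> \<le> P k' / R k"
        using R_pos[of k] P_pos[of k'] by (intro divide_left_mono) auto
      also have "\<dots> \<le> 1 / A k"
        using R_Suc_ge_P[of k'] R_pos[of k] A_ge_8[of k] by (simp add: k' field_simps)
      finally show "C k / d k ^ Suc j \<le> 1 / A k" .
    qed
    also have "\<dots> \<le> (1/2) ^ k / 8"
      using B[of k] k A_ge_8[of k] by (simp add: B0_def field_simps power_one_over)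
    also have "\<dots> \<le> weight N * (1/2) ^ k / 8"
      using weight_ge_P P_ge_1[of N] by simp
    finally show ?thesis .
  qed
  have main: "weight N / 2 \<le> cmod (e N * \<tau> N)"
  proof -
    have "cmod (\<Sum>j<N. \<beta> j * (C N * ((- 1) ^ j * fact j / (c - a N) ^ Suc j)))
        \<le> (\<Sum>j<N. cmod (\<beta> j) * fact j * (P N * d N))"
    proof (rule sum_norm_le)
      fix j assume "j \<in> {..<N}"
      then obtain i where i: "N = j + Suc i" using less_imp_Suc_add by auto
      have "C N / d N ^ Suc j = P N * d N ^ Suc i"
        using d_pos[of N] unfolding C_def i by (simp add: power_add)
      also have "\<dots> \<le> P N * (d N * 1)"
        unfolding power_Suc using d_pos[of N] d_le_1[of N] P_pos[of N]
        by (intro mult_left_mono power_le_one) auto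
      finally show "cmod (\<beta> j * (C N * ((- 1) ^ j * fact j / (c - a N) ^ Suc j)))
          \<le> cmod (\<beta> j) * fact j * (P N * d N)"
        unfolding norm_term by (intro mult_left_mono) auto
    qed
    also have "\<dots> \<le> B0 * (P N * d N)"
      unfolding B0_def sum_distrib_right using P_pos[of N] d_pos[of N]
      by (intro sum_mono2) auto
    also have "\<dots> \<le> P N * (1/2)"
    proof -
      have "B0 \<le> 8 * 2 ^ N * B0"
        using mult_right_mono[of 1 "8 * 2 ^ N" B0] B0 one_le_power[of "2::real" N] by linarith
      also have "\<dots> \<le> A N" using B[of N] by (simp add: B0_def)
      finally have "B0 * d N \<le> 1/2"
        using R_ge[of N] R_pos[of N] by (simp add: d_def field_simps)
      then show ?thesis
        using mult_left_mono[of "B0 * d N" "1/2" "P N"] P_pos[of N] by (simp add: mult_ac)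
    qed
    also have "\<dots> \<le> weight N / 2" using weight_ge_P by simp
    finally have lower:
      "cmod (\<Sum>j<N. \<beta> j * (C N * ((- 1) ^ j * fact j / (c - a N) ^ Suc j))) \<le> weight N / 2" .
    have top: "cmod (\<beta> N * (C N * ((- 1) ^ N * fact N / (c - a N) ^ Suc N)))
        = cmod (\<beta> N) * weight N"
      unfolding norm_term using d_pos[of N] by (simp add: C_def weight_def)
    have \<tau>N: "\<tau> N = (\<Sum>j<N. \<beta> j * (C N * ((- 1) ^ j * fact j / (c - a N) ^ Suc j)))
        + \<beta> N * (C N * ((- 1) ^ N * fact N / (c - a N) ^ Suc N))"
      unfolding \<tau>_def by (simp only: lessThan_Suc_atMost[symmetric] sum.lessThan_Suc)
    have "cmod (\<beta> N) * weight N - weight N / 2 \<le> cmod (\<tau> N)"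
      unfolding \<tau>N top[symmetric]
      using lower norm_diff_ineq[of "\<beta> N * (C N * ((- 1) ^ N * fact N / (c - a N) ^ Suc N))"
        "\<Sum>j<N. \<beta> j * (C N * ((- 1) ^ j * fact j / (c - a N) ^ Suc j))"]
      unfolding add.commute[of "\<beta> N * _"] by linarith
    then have "e N * (cmod (\<beta> N) * weight N - weight N / 2) \<le> e N * cmod (\<tau> N)"
      using e(1) by (rule mult_left_mono)
    moreover have "e N * (cmod (\<beta> N) * weight N - weight N / 2) = weight N - e N * weight N / 2"
      using e(4) by (simp add: right_diff_distrib flip: mult.assoc)
    moreover have "e N * weight N \<le> weight N"
      using e(2)[of N] weight_pos[of N] by simp
    ultimately show ?thesis using e(1)[of N] by (simp add: norm_mult)
  qed
  have other: "cmod (e k * \<tau> k) \<le> weight N * (1/2) ^ k / 8" if ne: "k \<noteq> N" for k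
  proof -
    consider "k < N" | "k = Suc N" | "N + 2 \<le> k" using ne by arith
    then show ?thesis
    proof cases
      case 1
      have "cmod (e k * \<tau> k) \<le> cmod (\<tau> k)"
        using e(1,2)[of k] by (simp add: norm_mult mult_left_le_one_le)
      also have "\<dots> \<le> weight N * (1/2) ^ N / 8" by (rule early[OF 1])
      also have "\<dots> \<le> weight N * (1/2) ^ k / 8"
        using 1 weight_pos[of N] by (intro divide_right_mono mult_left_mono power_decreasing) auto
      finally show ?thesis .
    next
      case 2
      then show ?thesis using e(3) weight_pos[of N] by (simp add: less_imp_le)
    next
      case 3
      have "cmod (e k * \<tau> k) \<le> cmod (\<tau> k)"
        using e(1,2)[of k] by (simp add: norm_mult mult_left_le_one_le)
      with late[OF 3] show ?thesis by linarith
    qed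
  qed
  have "cmod (\<Sum>k\<in>{..<K} - {N}. e k * \<tau> k) \<le> (\<Sum>k\<in>{..<K} - {N}. weight N * (1/2) ^ k / 8)"
    by (rule sum_norm_le) (use other in auto)
  also have "\<dots> \<le> (\<Sum>k<K. weight N * (1/2) ^ k / 8)"
    using weight_pos[of N] by (intro sum_mono2) auto
  also have "\<dots> = weight N / 8 * (\<Sum>k<K. (1/2) ^ k)"
    by (simp add: sum_distrib_left)
  also have "\<dots> \<le> weight N / 8 * 2"
    using weight_pos[of N] by (intro mult_left_mono) (auto simp: geometric_sum)
  finally have rest: "cmod (\<Sum>k\<in>{..<K} - {N}. e k * \<tau> k) \<le> weight N / 4" by simp
  have "(\<Sum>j\<le>N. \<beta> j * (\<Sum>k<K. e k * C k * ((- 1) ^ j * fact j / (c - a k) ^ Suc j)))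
      = (\<Sum>j\<le>N. \<Sum>k<K. e k * (\<beta> j * (C k * ((- 1) ^ j * fact j / (c - a k) ^ Suc j))))"
    unfolding sum_distrib_left by (intro sum.cong refl) (simp only: mult_ac of_real_mult)
  also have "\<dots> = (\<Sum>k<K. e k * \<tau> k)"
    unfolding \<tau>_def sum_distrib_left by (rule sum.swap)
  also have "\<dots> = e N * \<tau> N + (\<Sum>k\<in>{..<K} - {N}. e k * \<tau> k)"
    using NK by (intro sum.remove) auto
  finally show ?thesis
    using main rest norm_diff_ineq[of "e N * \<tau> N" "\<Sum>k\<in>{..<K} - {N}. e k * \<tau> k"] by simp
qed

end

lemma ex_rapid_growth:
  assumes "\<And>n. 8 * 2 ^ n \<le> A n"
  shows "\<exists>R. rapid_growth A R"
proof
  define R where "R = rec_nat (A 0) (\<lambda>n x. max (A (Suc n)) (A (Suc n) * (2 * x) ^ Suc n))"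
  have R_Suc: "R (Suc n) = max (A (Suc n)) (A (Suc n) * (2 * R n) ^ Suc n)" for n
    by (simp add: R_def)
  have "A n \<le> R n" for n
    by (cases n) (auto simp: R_Suc, simp add: R_def)
  then show "rapid_growth A R"
    using assms by unfold_locales (auto simp: R_Suc simp del: power_Suc)
qed

section \<open>The weight sequence and the function that is not preserved\<close>

text \<open>
  With \<open>u\<close> the direction from \<open>c\<close> to the centre of the external disc, the open disc of radius \<open>t\<close>
  around \<open>c + t * u\<close> lies in the external disc, so no point of \<open>X\<close> is closer to its centre than \<open>c\<close>.
\<close>

lemma external_circular_tangent_radius:
  assumes "external_circular_tangent X c"
  obtains r u where "0 < r" "cmod u = 1" "c \<in> X"
    "\<And>t z. 0 < t \<Longrightarrow> t \<le> r \<Longrightarrow> z \<in> X \<Longrightarrow> t \<le> cmod (z - (c + of_real t * u))"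
proof -
  obtain w r where r: "r > 0" and sub: "ball w r \<subseteq> - X" and cl: "closure (ball w r) \<inter> X = {c}"
    using assms unfolding external_circular_tangent_def by blast
  have c: "c \<in> X" "dist w c \<le> r" using cl r by auto
  then have wc: "cmod (w - c) = r"
    using sub by (force simp: dist_norm)
  define u where "u = (w - c) / of_real r"
  have "t \<le> cmod (z - (c + of_real t * u))" if t: "0 < t" "t \<le> r" and z: "z \<in> X" for t z
  proof -
    have "r \<le> cmod (w - z)" using z sub by (force simp: dist_norm)
    also have "\<dots> \<le> cmod (w - (c + of_real t * u)) + cmod ((c + of_real t * u) - z)"
      by (metis diff_add_cancel norm_triangle_ineq add_diff_eq)
    also have "w - (c + of_real t * u) = of_real (r - t) * u"
      using r by (simp add: u_def field_simps)
    also have "cmod (of_real (r - t) * u) = r - t"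
      using t r wc by (simp only: norm_mult norm_of_real) (simp add: u_def norm_divide)
    finally show ?thesis by (simp add: norm_minus_commute)
  qed
  moreover have "cmod u = 1" using r wc by (simp add: u_def norm_divide)
  ultimately show thesis using that r c(1) by blast
qed

theorem theorem5:
  fixes X :: "complex set" and \<phi> :: "complex \<Rightarrow> complex" and b :: complex
  assumes "perfect_compact X"
    and "good X"
    and "\<phi> ` X \<subseteq> X"
    and "\<phi> \<in> D_infinity X"
    and "b \<in> X"
    and "cmod (deriv_on X \<phi> b) > 1"
    and "external_circular_tangent X (\<phi> b)"
  shows "\<exists>M. weight_sequence M \<and> nonanalytic M \<and> \<phi> \<in> D_alg X M \<and>
             \<not> induces_endomorphism X M \<phi>"
proof -
  note X = assms(1) and img = assms(3) and \<phi> = assms(4) and b = assms(5)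
  define c where "c = \<phi> b"
  define \<rho> where "\<rho> = cmod (deriv_on X \<phi> b)"
  have \<rho>: "1 < \<rho>" using assms(6) by (simp add: \<rho>_def)
  obtain r u where r: "0 < r" and u: "cmod u = 1" and c: "c \<in> X"
    and radius: "\<And>t z. 0 < t \<Longrightarrow> t \<le> r \<Longrightarrow> z \<in> X \<Longrightarrow> t \<le> cmod (z - (c + of_real t * u))"
    using external_circular_tangent_radius[OF assms(7)] unfolding c_def by metis
  have "\<forall>n. \<exists>\<beta>. cmod (\<beta> n) = \<rho> ^ n \<and> (\<forall>f\<in>D_infinity X.
      higher_deriv_on X n (f \<circ> \<phi>) b = (\<Sum>j\<le>n. \<beta> j * higher_deriv_on X j f c))"
  proof
    fix n
    obtain \<beta> where "\<forall>z. \<beta> n z = deriv_on X \<phi> z ^ n"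
      "\<forall>f\<in>D_infinity X. \<forall>z\<in>X.
        higher_deriv_on X n (f \<circ> \<phi>) z = (\<Sum>j\<le>n. \<beta> j z * higher_deriv_on X j f (\<phi> z))"
      using higher_deriv_on_comp[OF X \<phi> img, of n] by blast
    then show "\<exists>\<beta>. cmod (\<beta> n) = \<rho> ^ n \<and> (\<forall>f\<in>D_infinity X.
        higher_deriv_on X n (f \<circ> \<phi>) b = (\<Sum>j\<le>n. \<beta> j * higher_deriv_on X j f c))"
      using b by (intro exI[of _ "\<lambda>j. \<beta> j b"]) (auto simp: norm_power \<rho>_def c_def)
  qed
  then obtain \<beta> where lead: "\<And>n. cmod (\<beta> n n) = \<rho> ^ n"
    and comp: "\<And>n f. f \<in> D_infinity X \<Longrightarrow>
      higher_deriv_on X n (f \<circ> \<phi>) b = (\<Sum>j\<le>n. \<beta> n j * higher_deriv_on X j f c)"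
    by metis
  define B where "B n = (\<Sum>j\<le>n. cmod (\<beta> n j) * fact j)" for n
  define S where "S n = sup_norm_on X (higher_deriv_on X n \<phi>)" for n
  \<comment> \<open>\<open>B\<close> serves the estimate of the derivatives of \<open>f \<circ> \<phi>\<close>, \<open>S\<close> puts \<open>\<phi>\<close> into the algebra, and
    \<open>1 / r\<close> puts the poles into the external disc.\<close>
  define A where "A n = 8 * 2 ^ n * (1 + (\<Sum>m\<le>n. B m) + (\<Sum>m\<le>n. S m)) + 1 / r" for n
  have B_nonneg: "0 \<le> B n" for n unfolding B_def by (intro sum_nonneg) auto
  have S_nonneg: "0 \<le> S n" for n
    unfolding S_def by (rule sup_norm_higher_deriv_on_nonneg[OF X \<phi>])
  have le_sums: "B n \<le> (\<Sum>m\<le>k. B m)" "S n \<le> (\<Sum>m\<le>k. S m)" if "n \<le> k" for n k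
    using that B_nonneg S_nonneg by (auto intro: member_le_sum)
  have A_ge_mult: "8 * 2 ^ k * x \<le> A k" if "x \<le> 1 + (\<Sum>m\<le>k. B m) + (\<Sum>m\<le>k. S m)" for k x
    using mult_left_mono[OF that, of "8 * 2 ^ k"] r by (simp add: A_def add_increasing2)
  have sums_nonneg: "0 \<le> (\<Sum>m\<le>k. B m)" "0 \<le> (\<Sum>m\<le>k. S m)" for k
    using B_nonneg S_nonneg by (auto intro: sum_nonneg)
  have A_ge: "8 * 2 ^ n \<le> A n" for n
    using A_ge_mult[of 1 n] sums_nonneg[of n] by simp
  have A_ge_B: "8 * 2 ^ k * B n \<le> A k" if "n \<le> k" for n k
    by (rule A_ge_mult) (use le_sums[OF that] sums_nonneg[of k] in linarith)
  have A_ge_S: "8 * 2 ^ k * S k \<le> A k" for k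
    by (rule A_ge_mult) (use le_sums[of k k] sums_nonneg[of k] in linarith)
  have A_ge_r: "1 / r \<le> A n" for n
    using sums_nonneg[of n] by (simp add: A_def)
  obtain R where "rapid_growth A R" using ex_rapid_growth[OF A_ge] by blast
  then interpret rapid_growth A R .

  have "\<phi> \<in> D_alg X weight"
  proof -
    have "summable (\<lambda>n. (1/2::real) ^ n)" by (rule summable_geometric) simp
    then have "summable (\<lambda>n. S n / weight n)"
    proof (rule summable_comparison_test')
      fix n :: nat assume "1 \<le> n"
      then obtain m where n: "n = Suc m" by (cases n) auto
      have "2 ^ n * S n \<le> 8 * 2 ^ n * S n" using S_nonneg[of n] by simp
      also have "\<dots> \<le> R n" using A_ge_S[of n] R_ge[of n] by linarith
      also have "\<dots> \<le> P n"
        using P_ge_1[of m] R_pos[of n] by (simp add: n P_Suc)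
      also have "\<dots> \<le> weight n"
        using P_pos[of n] fact_ge_1[of n, where ?'a = real] by (simp add: weight_def)
      finally show "norm (S n / weight n) \<le> (1/2) ^ n"
        using S_nonneg[of n] weight_pos[of n] by (simp add: field_simps power_one_over)
    qed
    with \<phi> show ?thesis by (simp add: D_alg_def S_def)
  qed
  moreover have "\<not> induces_endomorphism X weight \<phi>"
  proof
    assume endo: "induces_endomorphism X weight \<phi>"
    \<comment> \<open>The coefficients \<open>e k\<close> are summable because of \<open>\<rho> > 1\<close>, and for even \<open>k\<close> they just compensate
      the modulus of the factor \<open>\<phi>' b ^ k\<close> in the \<open>k\<close>-th derivative of the composite.\<close>
    define a where "a k = c + of_real (d k) * u" for k
    define e :: "nat \<Rightarrow> real" where "e k = (if even k then (1 / \<rho>) ^ k else 0)" for k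
    define F where "F K z = (\<Sum>k<K. complex_of_real (e k) * C k / (z - a k))" for K z
    have e: "0 \<le> e k" "e k \<le> (1 / \<rho>) ^ k" "e k \<le> 1" for k
      using \<rho> by (auto simp: e_def intro: power_le_one)
    have dist: "d k \<le> cmod (z - a k)" if "z \<in> X" for k z
      unfolding a_def
    proof (rule radius[OF d_pos _ that])
      have "1 / r \<le> 2 * R k" using A_ge_r[of k] R_ge[of k] R_pos[of k] by linarith
      then show "d k \<le> r" using r R_pos[of k] by (simp add: d_def field_simps)
    qed
    have dist_c: "cmod (c - a k) = d k" for k
      using d_pos[of k] u by (simp add: a_def norm_mult)
    have F: "F K \<in> D_alg X weight" for K
      by (rule pole_sum_in_D_alg(1)[where I = "{..<K}" and a = a, OF X dist]) (auto simp: F_def)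
    have F_deriv: "higher_deriv_on X j (F K) c
        = (\<Sum>k<K. e k * C k * ((- 1) ^ j * fact j / (c - a k) ^ Suc j))" for j K
    proof (rule higher_deriv_on_pole_sum(2)[OF X _ _ c])
      show "a k \<notin> X" for k
        using dist[of "a k" k] d_pos[of k] by auto
    qed (simp add: F_def)
    have "summable e"
    proof (rule summable_comparison_test')
      show "summable (\<lambda>k. (1 / \<rho>) ^ k)" by (rule summable_geometric) (use \<rho> in simp)
    qed (use e in simp)
    have Cauchy: "\<exists>N. \<forall>j\<ge>N. \<forall>k\<ge>N. D_norm X weight (\<lambda>z. F j z - F k z) < \<epsilon>" if eps: "0 < \<epsilon>" for \<epsilon>
    proof -
      obtain N where N: "\<And>m n. N \<le> m \<Longrightarrow> norm (sum e {m..<n}) < \<epsilon> / 3"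
        using \<open>summable e\<close>[unfolded summable_Cauchy, rule_format, of "\<epsilon> / 3"] eps by auto
      have "D_norm X weight (\<lambda>z. F j z - F k z) < \<epsilon>" if j: "N \<le> j" and k: "N \<le> k" for j k
      proof -
        \<comment> \<open>The sign covers both orders of \<open>j\<close> and \<open>k\<close>.\<close>
        define I where "I = {min j k..<max j k}"
        define s where "s i = complex_of_real (if k \<le> j then e i else - e i)" for i
        have "F j z - F k z = (\<Sum>i\<in>I. s i * C i / (z - a i))" for z
        proof (cases "k \<le> j")
          case True
          then show ?thesis
            unfolding F_def I_def s_def
            by (simp add: lessThan_atLeast0 sum_diff_nat_ivl min_def max_def)
        next
          case False
          then have "F k z - F j z = (\<Sum>i\<in>I. complex_of_real (e i) * C i / (z - a i))"
            unfolding F_def I_def by (simp add: lessThan_atLeast0 sum_diff_nat_ivl min_def max_def)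
          then have "F j z - F k z = - (\<Sum>i\<in>I. complex_of_real (e i) * C i / (z - a i))"
            by (simp add: algebra_simps)
          with False show ?thesis by (simp add: s_def sum_negf)
        qed
        then have "D_norm X weight (\<lambda>z. F j z - F k z) \<le> 3 * (\<Sum>i\<in>I. cmod (s i))"
          by (intro pole_sum_in_D_alg(2)[where a = a, OF X dist])
        also have "(\<Sum>i\<in>I. cmod (s i)) = sum e I"
          using e(1) by (intro sum.cong) (auto simp: s_def)
        also have "\<dots> < \<epsilon> / 3"
          using N[of "min j k" "max j k"] j k by (simp add: I_def)
        finally show ?thesis by simp
      qed
      then show ?thesis by blast
    qed
    have "D_complete X weight"
      using assms(2) weight_sequence nonanalytic unfolding good_def by blast
    then have "\<exists>f\<in>D_alg X weight. (\<lambda>k. D_norm X weight (\<lambda>z. F k z - f z)) \<longlonglongrightarrow> 0"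
      unfolding D_complete_def using F Cauchy by (elim allE[of _ F] impE) simp_all
    then obtain f where f: "f \<in> D_alg X weight"
      and lim: "(\<lambda>k. D_norm X weight (\<lambda>z. F k z - f z)) \<longlonglongrightarrow> 0"
      by blast
    have fD: "f \<in> D_infinity X" using f by (simp add: D_alg_def)
    have deriv_lim: "(\<lambda>K. higher_deriv_on X j (F K) c) \<longlonglongrightarrow> higher_deriv_on X j f c" for j
    proof (rule LIM_zero_cancel, rule tendsto_0_le[OF lim, of _ "weight j"],
        rule always_eventually, rule allI)
      fix K
      have "higher_deriv_on X j (F K) c - higher_deriv_on X j f c
          = higher_deriv_on X j (\<lambda>z. F K z - f z) c"
        using higher_deriv_on_diff(2)[OF X _ fD c] F[of K] by (simp add: D_alg_def)
      also have "cmod \<dots> \<le> weight j * D_norm X weight (\<lambda>z. F K z - f z)"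
        by (rule norm_higher_deriv_on_le_D_norm[OF X weight_pos D_alg_diff[OF X weight_pos F f] c])
      also have "\<dots> \<le> norm (D_norm X weight (\<lambda>z. F K z - f z)) * weight j"
        using weight_pos[of j] by simp
      finally show "norm (higher_deriv_on X j (F K) c - higher_deriv_on X j f c)
          \<le> norm (D_norm X weight (\<lambda>z. F K z - f z)) * weight j" .
    qed
    have f\<phi>: "f \<circ> \<phi> \<in> D_alg X weight"
      using endo f by (simp add: induces_endomorphism_def)
    then have f\<phi>D: "f \<circ> \<phi> \<in> D_infinity X" by (simp add: D_alg_def)
    have large: "1 / 4 \<le> sup_norm_on X (higher_deriv_on X N (f \<circ> \<phi>)) / weight N" if N: "even N" for N
    proof -
      have "(\<lambda>K. cmod (\<Sum>j\<le>N. \<beta> N j * higher_deriv_on X j (F K) c))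
          \<longlonglongrightarrow> cmod (\<Sum>j\<le>N. \<beta> N j * higher_deriv_on X j f c)"
        by (intro tendsto_intros deriv_lim)
      moreover have "weight N / 4 \<le> cmod (\<Sum>j\<le>N. \<beta> N j * higher_deriv_on X j (F K) c)"
        if "Suc N \<le> K" for K
        unfolding F_deriv
      proof (rule linear_form_pole_sum_ge[OF dist_c])
        show "8 * 2 ^ k * (\<Sum>j\<le>N. cmod (\<beta> N j) * fact j) \<le> A k" if "N \<le> k" for k
          using A_ge_B[OF that] by (simp add: B_def)
        show "1 \<le> cmod (\<beta> N N)" using \<rho> by (simp add: lead)
        show "e N * cmod (\<beta> N N) = 1"
          using \<rho> N by (simp add: lead e_def power_one_over)
        show "e (Suc N) = 0" using N by (simp add: e_def)
      qed (use e that in auto)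
      ultimately have "weight N / 4 \<le> cmod (\<Sum>j\<le>N. \<beta> N j * higher_deriv_on X j f c)"
        by (intro LIMSEQ_le_const) blast+
      also have "\<dots> = cmod (higher_deriv_on X N (f \<circ> \<phi>) b)"
        by (simp only: comp[OF fD])
      also have "\<dots> \<le> sup_norm_on X (higher_deriv_on X N (f \<circ> \<phi>))"
        by (rule norm_higher_deriv_on_le_sup_norm[OF X f\<phi>D b])
      finally show ?thesis using weight_pos[of N] by (simp add: field_simps)
    qed
    have "(\<lambda>n. sup_norm_on X (higher_deriv_on X n (f \<circ> \<phi>)) / weight n) \<longlonglongrightarrow> 0"
      using f\<phi> by (intro summable_LIMSEQ_zero) (simp add: D_alg_def)
    then have "eventually (\<lambda>n. sup_norm_on X (higher_deriv_on X n (f \<circ> \<phi>)) / weight n < 1/4) sequentially"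
      by (rule order_tendstoD) simp
    then obtain n0 where "\<And>n. n0 \<le> n \<Longrightarrow>
        sup_norm_on X (higher_deriv_on X n (f \<circ> \<phi>)) / weight n < 1/4"
      unfolding eventually_sequentially by blast
    from this[of "2 * n0"] large[of "2 * n0"] show False by simp
  qed
  ultimately show ?thesis using weight_sequence nonanalytic by blast
qed

end
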